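(* Let $(\mathfrak g,\cdot,\ast)$ be a compatible pre-Lie algebra over a field $\mathbb K$. If two infinitesimal deformations $(\mathfrak g,\cdot_t,\ast_t)$ and $(\mathfrak g,\cdot'_t,\ast'_t)$ of $(\mathfrak g,\cdot,\ast)$, generated by $(\omega_1,\omega_2)$ and $(\omega_1',\omega_2')$ respectively, are equivalent, then $(\omega_1,\omega_2)$ and $(\omega_1',\omega_2')$ are in the same cohomology class of $\mathcal H^2(\mathfrak g;\mathfrak g)$.
   Context: Pre-Lie algebra: a vector space with a bilinear product $\cdot$ satisfying $(x\cdot y)\cdot z-x\cdot(y\cdot z)=(y\cdot x)\cdot z-y\cdot(x\cdot z)$. Compatible pre-Lie algebra: a triple $(\mathfrak g,\cdot,\ast)$ where $\cdot$ and $\ast$ are pre-Lie products on $\mathfrak g$ such that for all $x,y,z$: $(x\ast y)\cdot z+(x\cdot y)\ast z-x\cdot(y\ast z)-x\ast(y\cdot z)-(y\ast x)\cdot z-(y\cdot x)\ast z+y\cdot(x\ast z)+y\ast(x\cdot z)=0$. A homomorphism of compatible pre-Lie algebras is a linear map preserving both products. Infinitesimal deformation: a pair $(\omega_1,\omega_2)$ of elements of $\mathrm{Hom}(\otimes^2\mathfrak g,\mathfrak g)$ generates an infinitesimal deformation of $(\mathfrak g,\cdot,\ast)$ if for all $t\in\mathbb K$ the products $x\cdot_ty=x\cdot y+t\omega_1(x,y)$, $x\ast_ty=x\ast y+t\omega_2(x,y)$ make $(\mathfrak g,\cdot_t,\ast_t)$ a compatible pre-Lie algebra. Two infinitesimal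 deformations $(\mathfrak g,\cdot_t,\ast_t)$ and $(\mathfrak g,\cdot_t',\ast_t')$ are equivalent if there is a linear operator $N\in\mathfrak{gl}(\mathfrak g)$ such that, for all $t\in\mathbb K$, $\mathrm{Id}+tN$ is a compatible pre-Lie algebra homomorphism from $(\mathfrak g,\cdot'_t,\ast'_t)$ to $(\mathfrak g,\cdot_t,\ast_t)$. Second cohomology: for a pre-Lie product $\pi$ on $\mathfrak g$, $f\in\mathrm{Hom}(\mathfrak g,\mathfrak g)$ and $\omega\in\mathrm{Hom}(\otimes^2\mathfrak g,\mathfrak g)$, put $(\delta_\pi f)(x,y)=\pi(x,f(y))+\pi(f(x),y)-f(\pi(x,y))$ and $(\delta_\pi\omega)(x,y,z)=\pi(x,\omega(y,z))-\pi(y,\omega(x,z))+\pi(\omega(y,x),z)-\pi(\omega(x,y),z)-\omega(y,\pi(x,z))+\omega(x,\pi(y,z))-\omega(\pi(x,y)-\pi(y,x),z)$. With $\pi_1=\cdot$, $\pi_2=\ast$: a $2$-cocycle is a pair $(\omega_1,\omega_2)$ with $\delta(\omega_1,\omega_2):=(\delta_{\pi_1}\omega_1,\ \delta_{\pi_2}\omega_1+\delta_{\pi_1}\omega_2,\ \delta_{\pi_2}\omega_2)=0$; a $2$-coboundary is a pair of the form $\delta f:=(\delta_{\pi_1}f,\delta_{\pi_2}f)$ with $f\in\mathrm{Hom}(\mathfrak g,\mathfrak g)$; $\mathcal H^2(\mathfrak g;\mathfrak g)$ is the quotient of $2$-cocycles by $2$-coboundaries.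
   Formalization: The field K is additionally assumed to have at least 4 elements (or be infinite); with t ranging only over K, the claim fails over the fields with 2 and 3 elements. *)

theory Defs
  imports Complex_Main
begin

definition bilinear_map :: "('k::field \<Rightarrow> 'v::ab_group_add \<Rightarrow> 'v) \<Rightarrow> ('v \<Rightarrow> 'v \<Rightarrow> 'v) \<Rightarrow> bool" where
  "bilinear_map scale \<omega> \<longleftrightarrow>
     (\<forall>x. Vector_Spaces.linear scale scale (\<omega> x)) \<and>
     (\<forall>y. Vector_Spaces.linear scale scale (\<lambda>x. \<omega> x y))"

locale pre_lie_algebra = vector_space scale
  for scale :: "'k::field \<Rightarrow> 'v::ab_group_add \<Rightarrow> 'v" +
  fixes \<pi> :: "'v \<Rightarrow> 'v \<Rightarrow> 'v"
  assumes bilinear: "bilinear_map scale \<pi>"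
    and pre_lie: "\<pi> (\<pi> x y) z - \<pi> x (\<pi> y z) = \<pi> (\<pi> y x) z - \<pi> y (\<pi> x z)"

locale compatible_pre_lie_algebra =
  dot: pre_lie_algebra scale dot + ast: pre_lie_algebra scale ast
  for scale :: "'k::field \<Rightarrow> 'v::ab_group_add \<Rightarrow> 'v"
    and dot :: "'v \<Rightarrow> 'v \<Rightarrow> 'v" (infixl "\<cdot>" 70)
    and ast :: "'v \<Rightarrow> 'v \<Rightarrow> 'v" (infixl "\<star>" 70) +
  assumes compatible:
    "(x \<star> y) \<cdot> z + (x \<cdot> y) \<star> z - x \<cdot> (y \<star> z) - x \<star> (y \<cdot> z)
     - (y \<star> x) \<cdot> z - (y \<cdot> x) \<star> z + y \<cdot> (x \<star> z) + y \<star> (x \<cdot> z) = 0"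

text \<open>Homomorphism from \<open>(g, dot', ast')\<close> to \<open>(g, dot, ast)\<close>; all structures considered here live
  on the same vector space.\<close>

definition compatible_pre_lie_hom ::
  "('k::field \<Rightarrow> 'v::ab_group_add \<Rightarrow> 'v) \<Rightarrow> ('v \<Rightarrow> 'v \<Rightarrow> 'v) \<Rightarrow> ('v \<Rightarrow> 'v \<Rightarrow> 'v) \<Rightarrow>
   ('v \<Rightarrow> 'v \<Rightarrow> 'v) \<Rightarrow> ('v \<Rightarrow> 'v \<Rightarrow> 'v) \<Rightarrow> ('v \<Rightarrow> 'v) \<Rightarrow> bool" where
  "compatible_pre_lie_hom scale dot' ast' dot ast \<phi> \<longleftrightarrow>
     Vector_Spaces.linear scale scale \<phi> \<and>
     (\<forall>x y. \<phi> (dot' x y) = dot (\<phi> x) (\<phi> y)) \<and>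
     (\<forall>x y. \<phi> (ast' x y) = ast (\<phi> x) (\<phi> y))"

definition deformed ::
  "('k::field \<Rightarrow> 'v::ab_group_add \<Rightarrow> 'v) \<Rightarrow> ('v \<Rightarrow> 'v \<Rightarrow> 'v) \<Rightarrow> ('v \<Rightarrow> 'v \<Rightarrow> 'v) \<Rightarrow> 'k \<Rightarrow> 'v \<Rightarrow> 'v \<Rightarrow> 'v" where
  "deformed scale \<pi> \<omega> t x y = \<pi> x y + scale t (\<omega> x y)"

definition generates_infinitesimal_deformation ::
  "('k::field \<Rightarrow> 'v::ab_group_add \<Rightarrow> 'v) \<Rightarrow> ('v \<Rightarrow> 'v \<Rightarrow> 'v) \<Rightarrow> ('v \<Rightarrow> 'v \<Rightarrow> 'v) \<Rightarrow>
   ('v \<Rightarrow> 'v \<Rightarrow> 'v) \<times> ('v \<Rightarrow> 'v \<Rightarrow> 'v) \<Rightarrow> bool" where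
  "generates_infinitesimal_deformation scale dot ast = (\<lambda>(\<omega>1, \<omega>2).
     bilinear_map scale \<omega>1 \<and> bilinear_map scale \<omega>2 \<and>
     (\<forall>t. compatible_pre_lie_algebra scale (deformed scale dot \<omega>1 t) (deformed scale ast \<omega>2 t)))"

text \<open>The deformation generated by \<open>(\<omega>1, \<omega>2)\<close> is equivalent to the one generated by
  \<open>(\<omega>1', \<omega>2')\<close>; the homomorphism goes from the primed deformation to the unprimed one.\<close>

definition equivalent_deformations ::
  "('k::field \<Rightarrow> 'v::ab_group_add \<Rightarrow> 'v) \<Rightarrow> ('v \<Rightarrow> 'v \<Rightarrow> 'v) \<Rightarrow> ('v \<Rightarrow> 'v \<Rightarrow> 'v) \<Rightarrow>
   ('v \<Rightarrow> 'v \<Rightarrow> 'v) \<times> ('v \<Rightarrow> 'v \<Rightarrow> 'v) \<Rightarrow> ('v \<Rightarrow> 'v \<Rightarrow> 'v) \<times> ('v \<Rightarrow> 'v \<Rightarrow> 'v) \<Rightarrow> bool" where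
  "equivalent_deformations scale dot ast = (\<lambda>(\<omega>1, \<omega>2) (\<omega>1', \<omega>2').
     (\<exists>N. Vector_Spaces.linear scale scale N \<and>
        (\<forall>t. compatible_pre_lie_hom scale
               (deformed scale dot \<omega>1' t) (deformed scale ast \<omega>2' t)
               (deformed scale dot \<omega>1 t) (deformed scale ast \<omega>2 t)
               (\<lambda>x. x + scale t (N x)))))"

definition delta1 :: "('v::ab_group_add \<Rightarrow> 'v \<Rightarrow> 'v) \<Rightarrow> ('v \<Rightarrow> 'v) \<Rightarrow> 'v \<Rightarrow> 'v \<Rightarrow> 'v" where
  "delta1 \<pi> f x y = \<pi> x (f y) + \<pi> (f x) y - f (\<pi> x y)"

definition delta2 :: "('v::ab_group_add \<Rightarrow> 'v \<Rightarrow> 'v) \<Rightarrow> ('v \<Rightarrow> 'v \<Rightarrow> 'v) \<Rightarrow> 'v \<Rightarrow> 'v \<Rightarrow> 'v \<Rightarrow> 'v" where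
  "delta2 \<pi> \<omega> x y z =
     \<pi> x (\<omega> y z) - \<pi> y (\<omega> x z) + \<pi> (\<omega> y x) z - \<pi> (\<omega> x y) z
     - \<omega> y (\<pi> x z) + \<omega> x (\<pi> y z) - \<omega> (\<pi> x y - \<pi> y x) z"

definition cocycles2 ::
  "('k::field \<Rightarrow> 'v::ab_group_add \<Rightarrow> 'v) \<Rightarrow> ('v \<Rightarrow> 'v \<Rightarrow> 'v) \<Rightarrow> ('v \<Rightarrow> 'v \<Rightarrow> 'v) \<Rightarrow>
   (('v \<Rightarrow> 'v \<Rightarrow> 'v) \<times> ('v \<Rightarrow> 'v \<Rightarrow> 'v)) set" where
  "cocycles2 scale \<pi>1 \<pi>2 = {(\<omega>1, \<omega>2).
     bilinear_map scale \<omega>1 \<and> bilinear_map scale \<omega>2 \<and>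
     (\<forall>x y z. delta2 \<pi>1 \<omega>1 x y z = 0 \<and>
              delta2 \<pi>2 \<omega>1 x y z + delta2 \<pi>1 \<omega>2 x y z = 0 \<and>
              delta2 \<pi>2 \<omega>2 x y z = 0)}"

definition coboundaries2 ::
  "('k::field \<Rightarrow> 'v::ab_group_add \<Rightarrow> 'v) \<Rightarrow> ('v \<Rightarrow> 'v \<Rightarrow> 'v) \<Rightarrow> ('v \<Rightarrow> 'v \<Rightarrow> 'v) \<Rightarrow>
   (('v \<Rightarrow> 'v \<Rightarrow> 'v) \<times> ('v \<Rightarrow> 'v \<Rightarrow> 'v)) set" where
  "coboundaries2 scale \<pi>1 \<pi>2 =
     {(delta1 \<pi>1 f, delta1 \<pi>2 f) |f. Vector_Spaces.linear scale scale f}"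

definition cohomologous2 ::
  "('k::field \<Rightarrow> 'v::ab_group_add \<Rightarrow> 'v) \<Rightarrow> ('v \<Rightarrow> 'v \<Rightarrow> 'v) \<Rightarrow> ('v \<Rightarrow> 'v \<Rightarrow> 'v) \<Rightarrow>
   (('v \<Rightarrow> 'v \<Rightarrow> 'v) \<times> ('v \<Rightarrow> 'v \<Rightarrow> 'v)) rel" where
  "cohomologous2 scale \<pi>1 \<pi>2 = {((\<omega>1, \<omega>2), (\<omega>1', \<omega>2')).
     (\<omega>1, \<omega>2) \<in> cocycles2 scale \<pi>1 \<pi>2 \<and> (\<omega>1', \<omega>2') \<in> cocycles2 scale \<pi>1 \<pi>2 \<and>
     ((\<lambda>x y. \<omega>1 x y - \<omega>1' x y), (\<lambda>x y. \<omega>2 x y - \<omega>2' x y)) \<in> coboundaries2 scale \<pi>1 \<pi>2}"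

definition cohomology2 ::
  "('k::field \<Rightarrow> 'v::ab_group_add \<Rightarrow> 'v) \<Rightarrow> ('v \<Rightarrow> 'v \<Rightarrow> 'v) \<Rightarrow> ('v \<Rightarrow> 'v \<Rightarrow> 'v) \<Rightarrow>
   (('v \<Rightarrow> 'v \<Rightarrow> 'v) \<times> ('v \<Rightarrow> 'v \<Rightarrow> 'v)) set set" where
  "cohomology2 scale \<pi>1 \<pi>2 = cocycles2 scale \<pi>1 \<pi>2 // cohomologous2 scale \<pi>1 \<pi>2"

text \<open>In a deformation, and in an equivalence of deformations, \<open>t\<close> ranges over the elements of the
  field. Coefficients of the resulting polynomial identities, whose degree in \<open>t\<close> is at most 3, can
  therefore be compared only over a field with at least 4 elements. Over the two smaller fields
  equivalent infinitesimal deformations need not be cohomologous: on a one-dimensional space with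
  both products zero and \<open>N = id\<close>, take \<open>\<omega>i = 0\<close> and \<open>\<omega>i' x y = x y\<close> over the field with 2 elements, and
  \<open>\<omega>i x y = x y\<close> and \<open>\<omega>i' x y = - x y\<close> over the field with 3 elements; there every coboundary is zero.\<close>

end

theory Submission
  imports Defs
begin

text \<open>Substituting the deformed products into the pre-Lie and compatibility identities gives
  polynomial identities in \<open>t\<close> whose linear coefficients are the components of
  \<open>\<delta>(\<omega>1, \<omega>2)\<close>, so both pairs are cocycles. The linear coefficient of the homomorphism condition
  for \<open>Id + t N\<close> reads \<open>\<omega>i' - \<omega>i = \<delta> N\<close>. All these polynomials have degree at most 3 and no constant
  term, so three distinct nonzero values of \<open>t\<close> force their linear coefficients to vanish.\<close>

text \<open>Removing 0 from at least four elements leaves three. The infinite case is a separate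
  disjunct because \<open>card\<close> of an infinite set is 0.\<close>

lemma obtain_three_distinct_nonzero:
  assumes "infinite (UNIV :: 'k set) \<or> card (UNIV :: 'k set) \<ge> 4"
  obtains p q r :: "'k::field"
  where "p \<noteq> 0" "q \<noteq> 0" "r \<noteq> 0" "p \<noteq> q" "p \<noteq> r" "q \<noteq> r"
proof -
  have "\<exists>T. T \<subseteq> UNIV - {0 :: 'k} \<and> card T = 3"
  proof (cases "finite (UNIV :: 'k set)")
    case True
    then have "3 \<le> card (UNIV - {0 :: 'k})"
      using assms by simp
    then show ?thesis
      by (meson obtain_subset_with_card_n)
  next
    case False
    then have "infinite (UNIV - {0 :: 'k})"
      by simp
    then show ?thesis
      using infinite_arbitrarily_large by blast
  qed
  then obtain T :: "'k set" where "T \<subseteq> UNIV - {0}" "card T = 3"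
    by blast
  with that show thesis
    by (auto simp: card_3_iff)
qed

text \<open>The coefficients are vectors, so Newton's divided differences replace a count of roots:
  after division by \<open>t\<close>, two rounds of differences at nonzero points isolate
  \<open>c\<close>, and then \<open>b\<close> and \<open>a\<close> follow by back
  substitution.\<close>

lemma (in vector_space) cubic_linear_coefficient_eq_0:
  assumes "infinite (UNIV :: 'a set) \<or> card (UNIV :: 'a set) \<ge> 4"
    and zero: "\<And>t. t *s a + (t * t) *s b + (t * t * t) *s c = 0"
  shows "a = 0"
proof -
  obtain p q r :: 'a where nz: "p \<noteq> 0" "q \<noteq> 0" "r \<noteq> 0" and ne: "p \<noteq> q" "p \<noteq> r" "q \<noteq> r"
    using obtain_three_distinct_nonzero assms(1) by metis
  have quad: "a + t *s b + (t * t) *s c = 0" if "t \<noteq> 0" for t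
  proof -
    have "t *s (a + t *s b + (t * t) *s c) = 0"
      using zero[of t] by (simp add: scale_right_distrib mult.assoc)
    then show ?thesis
      using that by simp
  qed
  \<comment> \<open>First divided difference of the quadratic, using
    \<open>t * t - u * u = (t - u) * (t + u)\<close>.\<close>
  have lin: "b + (t + u) *s c = 0" if "t \<noteq> 0" "u \<noteq> 0" "t \<noteq> u" for t u
  proof -
    have "(t - u) *s (b + (t + u) *s c)
        = (a + t *s b + (t * t) *s c) - (a + u *s b + (u * u) *s c)"
      by (simp add: algebra_simps)
    also have "\<dots> = 0"
      using that by (simp add: quad)
    finally show ?thesis
      using that by simp
  qed
  \<comment> \<open>Second divided difference: the pairs \<open>p, q\<close> and \<open>p, r\<close>
    share \<open>p\<close>, so \<open>b\<close> cancels.\<close>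
  have "(q - r) *s c = (b + (p + q) *s c) - (b + (p + r) *s c)"
    by (simp add: algebra_simps)
  also have "\<dots> = 0"
    using nz ne by (simp add: lin)
  finally have "c = 0"
    using ne by simp
  moreover from this have "b = 0"
    using lin[of p q] nz ne by simp
  ultimately show ?thesis
    using quad[of p] nz by simp
qed

lemma bilinear_mapD:
  assumes "bilinear_map scale \<omega>"
  shows "\<omega> (x + x') y = \<omega> x y + \<omega> x' y"
    and "\<omega> x (y + y') = \<omega> x y + \<omega> x y'"
    and "\<omega> (x - x') y = \<omega> x y - \<omega> x' y"
    and "\<omega> (scale t x) y = scale t (\<omega> x y)"
    and "\<omega> x (scale t y) = scale t (\<omega> x y)"
proof -
  interpret l: Vector_Spaces.linear scale scale "\<lambda>x. \<omega> x y" for y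
    using assms by (simp add: bilinear_map_def)
  interpret r: Vector_Spaces.linear scale scale "\<omega> x" for x
    using assms by (simp add: bilinear_map_def)
  show "\<omega> (x + x') y = \<omega> x y + \<omega> x' y" "\<omega> x (y + y') = \<omega> x y + \<omega> x y'"
    "\<omega> (x - x') y = \<omega> x y - \<omega> x' y" "\<omega> (scale t x) y = scale t (\<omega> x y)"
    "\<omega> x (scale t y) = scale t (\<omega> x y)"
    by (rule l.add r.add l.diff l.scale r.scale)+
qed

text \<open>The pre-Lie identity is \<open>pre_lie_defect \<pi> \<pi> = 0\<close>; compatibility and \<open>delta2\<close> are
  polarizations of it.\<close>

definition pre_lie_defect ::
  "('v::ab_group_add \<Rightarrow> 'v \<Rightarrow> 'v) \<Rightarrow> ('v \<Rightarrow> 'v \<Rightarrow> 'v) \<Rightarrow> 'v \<Rightarrow> 'v \<Rightarrow> 'v \<Rightarrow> 'v" where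
  "pre_lie_defect \<pi> \<sigma> x y z = \<pi> (\<sigma> x y) z - \<pi> x (\<sigma> y z) - \<pi> (\<sigma> y x) z + \<pi> y (\<sigma> x z)"

lemma (in pre_lie_algebra) pre_lie_defect_self: "pre_lie_defect \<pi> \<pi> x y z = 0"
  using pre_lie[of x y z] by (simp add: pre_lie_defect_def algebra_simps)

lemma (in compatible_pre_lie_algebra) pre_lie_defect_compatible:
  "pre_lie_defect dot ast x y z + pre_lie_defect ast dot x y z = 0"
  using compatible[of x y z] by (simp add: pre_lie_defect_def algebra_simps)

text \<open>Up to sign, \<open>delta2 \<pi> \<omega>\<close> is the derivative of the pre-Lie
  identity at \<open>\<pi>\<close> in direction \<open>\<omega>\<close>. Additivity of
  \<open>\<omega>\<close> splits the commutator in the last term of \<open>delta2\<close>.\<close>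

lemma delta2_eq_pre_lie_defect:
  assumes "bilinear_map scale \<omega>"
  shows "delta2 \<pi> \<omega> x y z = - (pre_lie_defect \<pi> \<omega> x y z + pre_lie_defect \<omega> \<pi> x y z)"
  by (simp add: delta2_def pre_lie_defect_def bilinear_mapD[OF assms])

text \<open>With outer and inner products kept independent, one expansion covers the pre-Lie
  identity of each deformed product as well as their compatibility.\<close>

lemma (in vector_space) pre_lie_defect_deformed:
  assumes "bilinear_map scale \<pi>" "bilinear_map scale \<omega>"
  shows "pre_lie_defect (deformed scale \<pi> \<omega> t) (deformed scale \<sigma> \<tau> t) x y z
    = pre_lie_defect \<pi> \<sigma> x y z
      + t *s (pre_lie_defect \<pi> \<tau> x y z + pre_lie_defect \<omega> \<sigma> x y z)
      + (t * t) *s pre_lie_defect \<omega> \<tau> x y z"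
  by (simp add: pre_lie_defect_def deformed_def bilinear_mapD[OF assms(1)]
      bilinear_mapD[OF assms(2)] algebra_simps)

lemma generates_infinitesimal_deformation_imp_cocycle:
  fixes scale :: "'k::field \<Rightarrow> 'v::ab_group_add \<Rightarrow> 'v"
  assumes card: "infinite (UNIV :: 'k set) \<or> card (UNIV :: 'k set) \<ge> 4"
    and "compatible_pre_lie_algebra scale dot ast"
    and gen: "generates_infinitesimal_deformation scale dot ast (\<omega>1, \<omega>2)"
  shows "(\<omega>1, \<omega>2) \<in> cocycles2 scale dot ast"
proof -
  interpret C: compatible_pre_lie_algebra scale dot ast by fact
  have \<omega>: "bilinear_map scale \<omega>1" "bilinear_map scale \<omega>2"
    and deformation:
      "\<And>t. compatible_pre_lie_algebra scale (deformed scale dot \<omega>1 t) (deformed scale ast \<omega>2 t)"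
    using gen by (auto simp: generates_infinitesimal_deformation_def)
  note bil = C.dot.bilinear C.ast.bilinear \<omega>
  \<comment> \<open>The inner products stay schematic, so these two facts expand both the pure and
    the mixed defects.\<close>
  note expand = C.dot.pre_lie_defect_deformed[OF bil(1,3)]
    C.dot.pre_lie_defect_deformed[OF bil(2,4)]
  let ?L = "\<lambda>\<pi> \<sigma>. pre_lie_defect \<pi> \<sigma>"
  have "delta2 dot \<omega>1 x y z = 0 \<and> delta2 ast \<omega>1 x y z + delta2 dot \<omega>2 x y z = 0
      \<and> delta2 ast \<omega>2 x y z = 0" for x y z
  proof (intro conjI)
    \<comment> \<open>The constant term vanishes because \<open>dot\<close> is pre-Lie; the zero
      cubic term only pads the polynomial to the shape of
      \<open>cubic_linear_coefficient_eq_0\<close>.\<close>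
    have dot0: "scale t (?L dot \<omega>1 x y z + ?L \<omega>1 dot x y z) + scale (t * t) (?L \<omega>1 \<omega>1 x y z)
        + scale (t * t * t) 0 = 0" for t
    proof -
      interpret D: compatible_pre_lie_algebra scale "deformed scale dot \<omega>1 t"
        "deformed scale ast \<omega>2 t" by (rule deformation)
      show ?thesis
        using D.dot.pre_lie_defect_self[of x y z]
        by (simp add: expand C.dot.pre_lie_defect_self)
    qed
    show "delta2 dot \<omega>1 x y z = 0"
      using C.dot.cubic_linear_coefficient_eq_0[OF card dot0]
      by (simp add: delta2_eq_pre_lie_defect[OF \<omega>(1)])
    have ast0: "scale t (?L ast \<omega>2 x y z + ?L \<omega>2 ast x y z) + scale (t * t) (?L \<omega>2 \<omega>2 x y z)
        + scale (t * t * t) 0 = 0" for t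
    proof -
      interpret D: compatible_pre_lie_algebra scale "deformed scale dot \<omega>1 t"
        "deformed scale ast \<omega>2 t" by (rule deformation)
      show ?thesis
        using D.ast.pre_lie_defect_self[of x y z]
        by (simp add: expand C.ast.pre_lie_defect_self)
    qed
    show "delta2 ast \<omega>2 x y z = 0"
      using C.dot.cubic_linear_coefficient_eq_0[OF card ast0]
      by (simp add: delta2_eq_pre_lie_defect[OF \<omega>(2)])
    have mixed0: "scale t (?L dot \<omega>2 x y z + ?L \<omega>1 ast x y z + (?L ast \<omega>1 x y z + ?L \<omega>2 dot x y z))
        + scale (t * t) (?L \<omega>1 \<omega>2 x y z + ?L \<omega>2 \<omega>1 x y z) + scale (t * t * t) 0 = 0"
      (is "?p t = 0") for t
    proof -
      interpret D: compatible_pre_lie_algebra scale "deformed scale dot \<omega>1 t"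
        "deformed scale ast \<omega>2 t" by (rule deformation)
      \<comment> \<open>Compatibility of \<open>dot\<close> and \<open>ast\<close> makes the
        constant term zero; restoring it turns \<open>?p t\<close> into the full expansion of the
        deformed compatibility identity.\<close>
      have "?p t = (?L dot ast x y z + ?L ast dot x y z) + ?p t"
        by (simp add: C.pre_lie_defect_compatible)
      also have "\<dots> = ?L (deformed scale dot \<omega>1 t) (deformed scale ast \<omega>2 t) x y z
          + ?L (deformed scale ast \<omega>2 t) (deformed scale dot \<omega>1 t) x y z"
        by (simp add: expand algebra_simps)
      also have "\<dots> = 0"
        by (rule D.pre_lie_defect_compatible)
      finally show ?thesis .
    qed
    have "delta2 ast \<omega>1 x y z + delta2 dot \<omega>2 x y z
        = - (?L dot \<omega>2 x y z + ?L \<omega>1 ast x y z + (?L ast \<omega>1 x y z + ?L \<omega>2 dot x y z))"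
      by (simp add: delta2_eq_pre_lie_defect[OF \<omega>(1)] delta2_eq_pre_lie_defect[OF \<omega>(2)])
    then show "delta2 ast \<omega>1 x y z + delta2 dot \<omega>2 x y z = 0"
      using C.dot.cubic_linear_coefficient_eq_0[OF card mixed0] by simp
  qed
  with \<omega> show ?thesis
    by (simp add: cocycles2_def)
qed

text \<open>Stated for a single product, so that it applies to \<open>dot\<close> and
  \<open>ast\<close> with the same \<open>N\<close>. The sign of \<open>- N\<close> matches the
  order of subtraction in \<open>cohomologous2\<close>.\<close>

lemma deformed_hom_imp_delta1:
  fixes scale :: "'k::field \<Rightarrow> 'v::ab_group_add \<Rightarrow> 'v"
  assumes card: "infinite (UNIV :: 'k set) \<or> card (UNIV :: 'k set) \<ge> 4"
    and "Vector_Spaces.linear scale scale N"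
    and \<pi>: "bilinear_map scale \<pi>" and \<omega>: "bilinear_map scale \<omega>"
    and hom: "\<And>t x y. deformed scale \<pi> \<omega>' t x y + scale t (N (deformed scale \<pi> \<omega>' t x y))
      = deformed scale \<pi> \<omega> t (x + scale t (N x)) (y + scale t (N y))"
  shows "\<omega> x y - \<omega>' x y = delta1 \<pi> (\<lambda>x. - N x) x y"
proof -
  interpret N: Vector_Spaces.linear scale scale N by fact
  \<comment> \<open>The constant terms \<open>\<pi> x y\<close> cancel. Both arguments on the right
    carry a factor \<open>t\<close> on \<open>N\<close>, so \<open>\<omega>\<close> contributes the
    cubic term.\<close>
  have "scale t (\<omega> x y - \<omega>' x y + \<pi> x (N y) + \<pi> (N x) y - N (\<pi> x y))
      + scale (t * t) (\<pi> (N x) (N y) + \<omega> x (N y) + \<omega> (N x) y - N (\<omega>' x y))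
      + scale (t * t * t) (\<omega> (N x) (N y))
      = deformed scale \<pi> \<omega> t (x + scale t (N x)) (y + scale t (N y))
        - (deformed scale \<pi> \<omega>' t x y + scale t (N (deformed scale \<pi> \<omega>' t x y)))" for t
    by (simp add: deformed_def bilinear_mapD[OF \<pi>] bilinear_mapD[OF \<omega>] N.add N.scale
        algebra_simps)
  then have "scale t (\<omega> x y - \<omega>' x y + \<pi> x (N y) + \<pi> (N x) y - N (\<pi> x y))
      + scale (t * t) (\<pi> (N x) (N y) + \<omega> x (N y) + \<omega> (N x) y - N (\<omega>' x y))
      + scale (t * t * t) (\<omega> (N x) (N y)) = 0" for t
    by (simp only: hom diff_self)
  then have coefficient: "\<omega> x y - \<omega>' x y + \<pi> x (N y) + \<pi> (N x) y - N (\<pi> x y) = 0"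
    by (rule N.vs1.cubic_linear_coefficient_eq_0[OF card])
  interpret \<pi>r: Vector_Spaces.linear scale scale "\<pi> x" for x
    using \<pi> by (simp add: bilinear_map_def)
  interpret \<pi>l: Vector_Spaces.linear scale scale "\<lambda>x. \<pi> x y" for y
    using \<pi> by (simp add: bilinear_map_def)
  show ?thesis
    using coefficient
    by (simp add: delta1_def \<pi>r.neg \<pi>l.neg algebra_simps)
qed

theorem theorem3p6:
  fixes scale :: "'k::field \<Rightarrow> 'v::ab_group_add \<Rightarrow> 'v"
    and dot ast \<omega>1 \<omega>2 \<omega>1' \<omega>2' :: "'v \<Rightarrow> 'v \<Rightarrow> 'v"
  assumes "infinite (UNIV :: 'k set) \<or> card (UNIV :: 'k set) \<ge> 4"
    and "compatible_pre_lie_algebra scale dot ast"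
    and "generates_infinitesimal_deformation scale dot ast (\<omega>1, \<omega>2)"
    and "generates_infinitesimal_deformation scale dot ast (\<omega>1', \<omega>2')"
    and "equivalent_deformations scale dot ast (\<omega>1, \<omega>2) (\<omega>1', \<omega>2')"
  shows "\<exists>c \<in> cohomology2 scale dot ast. (\<omega>1, \<omega>2) \<in> c \<and> (\<omega>1', \<omega>2') \<in> c"
proof -
  interpret C: compatible_pre_lie_algebra scale dot ast by fact
  interpret P: vector_space_pair scale scale ..
  have cocycle: "(\<omega>1, \<omega>2) \<in> cocycles2 scale dot ast" "(\<omega>1', \<omega>2') \<in> cocycles2 scale dot ast"
    using generates_infinitesimal_deformation_imp_cocycle assms(1-4) by blast+
  have \<omega>: "bilinear_map scale \<omega>1" "bilinear_map scale \<omega>2"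
    using cocycle(1) by (simp_all add: cocycles2_def)
  obtain N where N: "Vector_Spaces.linear scale scale N"
    and hom: "\<And>t. compatible_pre_lie_hom scale
      (deformed scale dot \<omega>1' t) (deformed scale ast \<omega>2' t)
      (deformed scale dot \<omega>1 t) (deformed scale ast \<omega>2 t) (\<lambda>x. x + scale t (N x))"
    using assms(5) by (auto simp: equivalent_deformations_def)
  have "\<omega>1 x y - \<omega>1' x y = delta1 dot (\<lambda>x. - N x) x y"
    "\<omega>2 x y - \<omega>2' x y = delta1 ast (\<lambda>x. - N x) x y" for x y
    using deformed_hom_imp_delta1[OF assms(1) N C.dot.bilinear \<omega>(1)]
      deformed_hom_imp_delta1[OF assms(1) N C.ast.bilinear \<omega>(2)] hom
    by (auto simp: compatible_pre_lie_hom_def)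
  moreover have "Vector_Spaces.linear scale scale (\<lambda>x. - N x)"
    using N by (rule P.linear_compose_neg)
  ultimately have "((\<lambda>x y. \<omega>1 x y - \<omega>1' x y), (\<lambda>x y. \<omega>2 x y - \<omega>2' x y))
      \<in> coboundaries2 scale dot ast"
    by (auto simp: coboundaries2_def intro!: exI[of _ "\<lambda>x. - N x"])
  then have "((\<omega>1, \<omega>2), (\<omega>1', \<omega>2')) \<in> cohomologous2 scale dot ast"
    using cocycle by (simp add: cohomologous2_def)
  \<comment> \<open>The common class is the image of \<open>(\<omega>1, \<omega>2)\<close> under the
    relation, so this pair must be related to itself; the zero map witnesses that the zero
    difference is a coboundary.\<close>
  moreover have "((\<omega>1, \<omega>2), (\<omega>1, \<omega>2)) \<in> cohomologous2 scale dot ast"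
  proof -
    have "delta1 dot (\<lambda>_. 0) x y = 0" "delta1 ast (\<lambda>_. 0) x y = 0" for x y
      using bilinear_mapD(3)[OF C.dot.bilinear, of 0 0 y]
        bilinear_mapD(5)[OF C.dot.bilinear, of x 0 0]
        bilinear_mapD(3)[OF C.ast.bilinear, of 0 0 y]
        bilinear_mapD(5)[OF C.ast.bilinear, of x 0 0]
      by (simp_all add: delta1_def)
    then have "((\<lambda>x y. 0), (\<lambda>x y. 0)) \<in> coboundaries2 scale dot ast"
      using P.linear_zero
      by (auto simp: coboundaries2_def fun_eq_iff intro!: exI[of _ "\<lambda>_. 0"])
    then show ?thesis
      using cocycle by (simp add: cohomologous2_def)
  qed
  ultimately show ?thesis
    using quotientI[OF cocycle(1), of "cohomologous2 scale dot ast"]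
    by (intro bexI[of _ "cohomologous2 scale dot ast `` {(\<omega>1, \<omega>2)}"])
      (auto simp: cohomology2_def)
qed

end
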